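(* Let $\xi\in[0,1[$ and $\eta\in\mathbb R$, and let $p,q\colon[0,1[\to\mathbb R$ be continuous functions that are integrable on $[0,1[$, i.e. $\int_0^1|p(x)|\,dx<\infty$ and $\int_0^1|q(x)|\,dx<\infty$. Then there exists $n^*\in\mathbb N$ such that for every $n\ge n^*$ the discretized integral equation $$\overline{y}_n(x)=\eta+S_{2^n}\left(\int_{\xi}^{\cdot}\big(S_{2^n}q(t)-S_{2^n}p(t)\,\overline{y}_n(t)\big)\,dt\right)(x),\qquad x\in[0,1[,$$ has at least one solution $\overline{y}_n$ that is a Walsh polynomial of the form $\overline{y}_n=\sum_{k=0}^{2^n-1}c_k\omega_k$ with real coefficients $c_0,\dots,c_{2^n-1}$.
   Context: Notation: $[0,1[$ is the half-open interval $\{x: 0\le x<1\}$. Each $x\in[0,1[$ is written as $x=\sum_{k=0}^\infty x_k2^{-(k+1)}$ with $x_k\in\{0,1\}$, where for dyadic rationals the expansion terminating in zeros is chosen. Each $n\in\mathbb N$ is written as $n=\sum_{k=0}^\infty n_k2^k$ with $n_k\in\{0,1\}$. The Rademacher functions are $r_k(x)=(-1)^{x_k}$, and the Walsh functions in the Paley enumeration are $\omega_n(x)=\prod_{k=0}^\infty r_k(x)^{n_k}$ ($x\in[0,1[$, $n\in\mathbb N=\{0,1,2,\dots\}$). For integrable $f$ on $[0,1[$, the Walsh-Fourier coefficients are $\widehat f_k=\int_0^1 f(x)\omega_k(x)\,dx$ and the partial sums are $S_mf(x)=\sum_{k=0}^{m-1}\widehat f_k\,\omega_k(x)$. Equivalently,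 $S_{2^n}f(x)=2^n\int_{I_n(x)}f(y)\,dy$, where $I_n(x)$ is the dyadic interval $[\frac{i-1}{2^n},\frac{i}{2^n}[$ ($1\le i\le 2^n$) containing $x$. In the equation, $S_{2^n}$ is applied to the function $s\mapsto\int_\xi^s(\cdots)\,dt$ on $[0,1[$, with the usual oriented-integral convention $\int_\xi^s=-\int_s^\xi$ when $s<\xi$. The equation is the discretization of the integral form of the Cauchy problem $y'+p(x)y=q(x)$, $y(\xi)=\eta$, on $[0,1[$. *)

theory Defs
  imports "HOL-Analysis.Analysis"
begin

(* The expansion of x in [0,1[ that does not end in an infinite string of ones; see
   binary_digit_sums and binary_digit_infinitely_many_zeros. *)
definition binary_digit :: "nat \<Rightarrow> real \<Rightarrow> nat" where
  "binary_digit k x = nat (\<lfloor>2 ^ Suc k * x\<rfloor> mod 2)"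

definition rademacher :: "nat \<Rightarrow> real \<Rightarrow> real" where
  "rademacher k x = (- 1) ^ binary_digit k x"

definition walsh :: "nat \<Rightarrow> real \<Rightarrow> real" where
  "walsh n x = (\<Prod>k. rademacher k x ^ of_bool (bit n k))"

definition walsh_coeff :: "(real \<Rightarrow> real) \<Rightarrow> nat \<Rightarrow> real" where
  "walsh_coeff f k = (LBINT x:{0..<1}. f x * walsh k x)"

definition walsh_partial_sum :: "nat \<Rightarrow> (real \<Rightarrow> real) \<Rightarrow> real \<Rightarrow> real" where
  "walsh_partial_sum m f x = (\<Sum>k<m. walsh_coeff f k * walsh k x)"

(* Functions on [0,1[ are total functions of which only the values on [0,1[ matter. *)
definition discretized_solution ::
  "real \<Rightarrow> real \<Rightarrow> (real \<Rightarrow> real) \<Rightarrow> (real \<Rightarrow> real) \<Rightarrow> nat \<Rightarrow> (real \<Rightarrow> real) \<Rightarrow> bool" where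
  "discretized_solution \<xi> \<eta> p q n y \<longleftrightarrow>
     (\<forall>x\<in>{0..<1}. y x = \<eta> + walsh_partial_sum (2 ^ n)
        (\<lambda>s. LBINT t=ereal \<xi>..ereal s.
           walsh_partial_sum (2 ^ n) q t - walsh_partial_sum (2 ^ n) p t * y t) x)"

lemma binary_digit_step:
  "real_of_int \<lfloor>2 ^ Suc k * x\<rfloor> = 2 * of_int \<lfloor>2 ^ k * x\<rfloor> + real (binary_digit k x)"
proof -
  have "\<lfloor>2 ^ Suc k * x\<rfloor> div 2 = \<lfloor>(2 ^ Suc k * x) / real_of_int 2\<rfloor>"
    using floor_divide_real_eq_div[of 2 "2 ^ Suc k * x"] by simp
  then have "\<lfloor>2 ^ Suc k * x\<rfloor> div 2 = \<lfloor>2 ^ k * x\<rfloor>" by simp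
  then have "\<lfloor>2 ^ Suc k * x\<rfloor> = 2 * \<lfloor>2 ^ k * x\<rfloor> + int (binary_digit k x)"
    using mult_div_mod_eq[of 2 "\<lfloor>2 ^ Suc k * x\<rfloor>"] by (simp add: binary_digit_def)
  then show ?thesis by simp
qed

lemma binary_digit_sums:
  assumes "x \<in> {0..<1}"
  shows "(\<lambda>k. real (binary_digit k x) / 2 ^ Suc k) sums x"
proof -
  have eq: "(\<Sum>k<n. real (binary_digit k x) / 2 ^ Suc k) = of_int \<lfloor>2 ^ n * x\<rfloor> / 2 ^ n" for n
  proof (induction n)
    case 0
    then show ?case using assms by (simp add: floor_eq_iff)
  next
    case (Suc n)
    then show ?case using binary_digit_step[of n x] by (simp add: field_simps)
  qed
  have lower: "x - (1 / 2) ^ n \<le> of_int \<lfloor>2 ^ n * x\<rfloor> / 2 ^ n" for n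
  proof -
    have "2 ^ n * x - 1 \<le> of_int \<lfloor>2 ^ n * x\<rfloor>" by linarith
    then have "(2 ^ n * x - 1) / 2 ^ n \<le> of_int \<lfloor>2 ^ n * x\<rfloor> / 2 ^ n"
      by (rule divide_right_mono) simp
    then show ?thesis by (simp add: diff_divide_distrib power_one_over)
  qed
  have upper: "of_int \<lfloor>2 ^ n * x\<rfloor> / 2 ^ n \<le> x" for n
    by (simp add: divide_le_eq mult.commute)
  have lim: "(\<lambda>n. x - (1 / 2) ^ n) \<longlonglongrightarrow> x"
    using tendsto_diff[OF tendsto_const[of x] LIMSEQ_realpow_zero[of "1 / 2"]] by simp
  have "(\<lambda>n. of_int \<lfloor>2 ^ n * x\<rfloor> / 2 ^ n) \<longlonglongrightarrow> x"
    by (rule tendsto_sandwich[OF _ _ lim tendsto_const])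
      (use lower upper in \<open>simp_all only: eventually_True\<close>)
  then show ?thesis unfolding sums_def eq .
qed

lemma binary_digit_infinitely_many_zeros: "\<exists>k\<ge>m. binary_digit k x = 0"
proof (rule ccontr)
  assume "\<not> (\<exists>k\<ge>m. binary_digit k x = 0)"
  then have nz: "binary_digit k x \<noteq> 0" if "m \<le> k" for k
    using that by simp
  have le1: "binary_digit k x \<le> 1" for k
  proof -
    have "z mod 2 \<le> 1" for z :: int using pos_mod_bound[of 2 z] by simp
    then show ?thesis unfolding binary_digit_def nat_le_iff by simp
  qed
  have one: "binary_digit k x = 1" if "k \<ge> m" for k
    using nz[OF that] le1[of k] by linarith
  define F where "F j = real_of_int \<lfloor>2 ^ j * x\<rfloor>" for j
  have F_le: "F j \<le> 2 ^ j * x" and less_F: "2 ^ j * x < F j + 1" for j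
    unfolding F_def by linarith+
  have F_Suc: "F (Suc (m + j)) = 2 * F (m + j) + 1" for j
    unfolding F_def binary_digit_step one[OF le_add1] by simp
  have F_add: "F (m + j) + 1 = 2 ^ j * (F m + 1)" for j
    by (induction j) (simp_all add: F_Suc)
  define d where "d = F m + 1 - 2 ^ m * x"
  have "0 < d" using less_F[of m] by (simp add: d_def)
  have le: "2 ^ j * d \<le> 1" for j
  proof -
    have "2 ^ j * d = F (m + j) + 1 - 2 ^ (m + j) * x"
      unfolding F_add by (simp add: d_def right_diff_distrib power_add mult_ac)
    then show ?thesis using F_le[of "m + j"] by linarith
  qed
  obtain j where "1 / d < 2 ^ j" using real_arch_pow[of 2 "1 / d"] by fastforce
  then have "1 < 2 ^ j * d" using \<open>0 < d\<close> by (simp add: divide_less_eq)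
  with le[of j] show False by linarith
qed

lemma walsh_eq_finite_prod: "walsh n x = (\<Prod>k | bit n k. rademacher k x)"
proof -
  have "k < n" if "bit n k" for k
  proof -
    have "odd (n div 2 ^ k)" using that unfolding bit_iff_odd .
    then have "n div 2 ^ k \<noteq> 0" by (metis even_zero)
    then have "2 ^ k \<le> n" by (simp add: div_eq_0_iff)
    then show ?thesis using less_exp[of k] by linarith
  qed
  then have "{k. bit n k} \<subseteq> {..<n}" by blast
  then have "finite {k. bit n k}" by (rule finite_subset) simp
  then show ?thesis unfolding walsh_def by (subst prodinf_finite) auto
qed

end

theory Submission
  imports Defs
begin

text \<open>
  Up to level \<open>n\<close> the Walsh system sees only dyadic averages. Because of the product formula for
  the kernel (\<open>walsh_kernel\<close>), the Walsh polynomials of degree less than \<open>2 ^ n\<close> are exactly the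
  functions that are constant on the dyadic intervals of length \<open>2 ^ -n\<close>, and the partial sum of
  order \<open>2 ^ n\<close> replaces a function by its averages over these intervals. The unknown is thus a
  vector \<open>Y\<close> with \<open>2 ^ n\<close> entries. For such a step function the integrand is a step function with
  integrals \<open>d i = b i - a i * Y i\<close>, where \<open>a i\<close> and \<open>b i\<close> are the integrals of \<open>p\<close> and \<open>q\<close> over the
  \<open>i\<close>-th interval; its primitive is piecewise linear, and averaging the primitive over an interval
  means evaluating it at the midpoint. The equation becomes the linear system
  \<open>Y i = \<eta> + ((\<Sum>j<i. d j) + d i / 2 - G)\<close>, with \<open>G\<close> the value of the primitive at \<open>\<xi>\<close>
  (\<open>discretized_solution_step_function\<close>).

  This system is a trapezoidal rule. Subtracting consecutive equations leaves
  \<open>(1 + a (i + 1) / 2) * Y (i + 1) = (1 - a i / 2) * Y i + (b i + b (i + 1)) / 2\<close>,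
  while the equation of the interval that contains \<open>\<xi>\<close> involves only the entry of \<open>Y\<close> on that
  interval. As soon as every \<open>a i\<close> is less than 2 in absolute value, that single entry can be computed,
  and the recursion can be run from it in both directions (\<open>nodal_system_solvable\<close>). The
  smallness holds for all large \<open>n\<close>, because the primitive of an integrable function is
  uniformly continuous (\<open>integral_dyadic_interval_small\<close>).
\<close>

section \<open>Dyadic intervals\<close>

definition dyadic_interval :: "nat \<Rightarrow> nat \<Rightarrow> real set" where
  "dyadic_interval n i = {real i / 2 ^ n..<real (Suc i) / 2 ^ n}"

definition dyadic_index :: "nat \<Rightarrow> real \<Rightarrow> nat" where
  "dyadic_index n x = nat \<lfloor>2 ^ n * x\<rfloor>"

lemma dyadic_index_bounds:
  assumes "0 \<le> x"
  shows "real (dyadic_index n x) \<le> 2 ^ n * x" "2 ^ n * x < real (dyadic_index n x) + 1"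
  unfolding dyadic_index_def using assms by (simp_all add: of_nat_floor)

lemma dyadic_index_eq_iff:
  assumes "0 \<le> x"
  shows "dyadic_index n x = i \<longleftrightarrow> x \<in> dyadic_interval n i"
proof -
  have "dyadic_index n x = i \<longleftrightarrow> real i \<le> 2 ^ n * x \<and> 2 ^ n * x < real i + 1"
    using dyadic_index_bounds[OF assms, of n] by linarith
  then show ?thesis by (simp add: dyadic_interval_def field_simps)
qed

lemma dyadic_index_less:
  assumes "x \<in> {0..<1}"
  shows "dyadic_index n x < 2 ^ n"
proof -
  have "2 ^ n * x < 2 ^ n" using assms by simp
  moreover have "real (dyadic_index n x) \<le> 2 ^ n * x"
    using assms by (intro dyadic_index_bounds) simp
  ultimately have "real (dyadic_index n x) < 2 ^ n" by linarith
  then show ?thesis by simp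
qed

lemma dyadic_interval_subset:
  assumes "i < 2 ^ n"
  shows "dyadic_interval n i \<subseteq> {0..<1}"
proof -
  have "real (Suc i) \<le> 2 ^ n" using assms
    by (metis Suc_leI of_nat_le_iff of_nat_numeral of_nat_power)
  then have "real (Suc i) / 2 ^ n \<le> 1" by simp
  moreover have "0 \<le> real i / 2 ^ n" by simp
  ultimately show ?thesis
    unfolding dyadic_interval_def by (auto simp del: of_nat_Suc)
qed

section \<open>The Dirichlet kernel of order a power of two\<close>

lemma rademacher_cases: "rademacher k x = 1 \<or> rademacher k x = - 1"
  unfolding rademacher_def by (simp add: minus_one_power_iff)

lemma rademacher_eq_iff: "rademacher k x = rademacher k y \<longleftrightarrow> binary_digit k x = binary_digit k y"
proof -
  have "binary_digit k z = 0 \<or> binary_digit k z = 1" for z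
    unfolding binary_digit_def by (simp add: nat_eq_iff) presburger
  from this[of x] this[of y] show ?thesis unfolding rademacher_def by auto
qed

text \<open>Adding the new top binary digit \<open>2 ^ n\<close> to \<open>k\<close> adds exactly the factor \<open>rademacher n\<close>. So
  doubling the range of summation in the kernel multiplies it by one factor.\<close>

lemma walsh_add_power:
  assumes "k < 2 ^ n"
  shows "walsh (2 ^ n + k) x = rademacher n x * walsh k x"
proof -
  have "take_bit n k = k" using assms by (rule take_bit_nat_eq_self)
  then have high: "\<not> bit k j" if "n \<le> j" for j
    using that by (metis bit_take_bit_iff not_le)
  have "and (2 ^ n) k = 0" using high[of n]
    by (intro bit_eqI) (auto simp: bit_and_iff bit_exp_iff)
  then have "2 ^ n + k = or (2 ^ n) k" by (rule disjunctive_add_eq_or)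
  then have bits: "{j. bit (2 ^ n + k) j} = insert n {j. bit k j}"
    by (auto simp: bit_or_iff bit_exp_iff)
  have "{j. bit k j} \<subseteq> {..<n}" using high not_le by blast
  then have "finite {j. bit k j}" by (rule finite_subset) simp
  then show ?thesis using high[of n] unfolding walsh_eq_finite_prod bits by simp
qed

lemma walsh_kernel_prod:
  "(\<Sum>k<2 ^ n. walsh k x * walsh k y) = (\<Prod>j<n. 1 + rademacher j x * rademacher j y)"
proof (induction n)
  case 0
  then show ?case by (simp add: walsh_eq_finite_prod)
next
  case (Suc n)
  have "(\<Sum>k<2 ^ Suc n. walsh k x * walsh k y)
      = (\<Sum>k<2 ^ n. walsh k x * walsh k y)
        + (\<Sum>k<2 ^ n. walsh (2 ^ n + k) x * walsh (2 ^ n + k) y)"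
    using sum.atLeastLessThan_concat[of 0 "2 ^ n" "2 ^ n + 2 ^ n :: nat" "\<lambda>k. walsh k x * walsh k y"]
      sum.shift_bounds_nat_ivl[of "\<lambda>k. walsh k x * walsh k y" 0 "2 ^ n" "2 ^ n"]
    by (simp add: atLeast0LessThan mult_2 add.commute)
  also have "\<dots> = (1 + rademacher n x * rademacher n y) * (\<Sum>k<2 ^ n. walsh k x * walsh k y)"
    by (simp add: walsh_add_power sum_distrib_left ring_distribs sum.distrib mult_ac)
  finally show ?case using Suc.IH by (simp add: mult.commute)
qed

text \<open>The first \<open>n\<close> digits of \<open>x\<close> are the binary digits of the integer part of \<open>2 ^ n * x\<close>, by
  induction on \<open>n\<close>; the integer part of \<open>x\<close> itself must agree at the start, hence the restriction
  to the unit interval.\<close>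

lemma binary_digits_eq_iff:
  assumes "x \<in> {0..<1}" "y \<in> {0..<1}"
  shows "(\<forall>j<n. binary_digit j x = binary_digit j y) \<longleftrightarrow> dyadic_index n x = dyadic_index n y"
proof -
  have "(\<forall>j<n. binary_digit j x = binary_digit j y) \<longleftrightarrow> \<lfloor>2 ^ n * x\<rfloor> = \<lfloor>2 ^ n * y\<rfloor>"
  proof (induction n)
    case 0
    have "\<lfloor>x\<rfloor> = 0" "\<lfloor>y\<rfloor> = 0" using assms by (simp_all add: floor_eq_iff)
    then show ?case by simp
  next
    case (Suc n)
    have step: "\<lfloor>2 ^ Suc n * z\<rfloor> = 2 * \<lfloor>2 ^ n * z\<rfloor> + int (binary_digit n z)" for z
      using binary_digit_step[of n z] by linarith
    have small: "binary_digit n z < 2" for z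
      unfolding binary_digit_def by (simp add: nat_less_iff)
    have "\<lfloor>2 ^ Suc n * x\<rfloor> = \<lfloor>2 ^ Suc n * y\<rfloor> \<longleftrightarrow>
        \<lfloor>2 ^ n * x\<rfloor> = \<lfloor>2 ^ n * y\<rfloor> \<and> binary_digit n x = binary_digit n y"
      unfolding step using small[of x] small[of y] by presburger
    then show ?case using Suc.IH by (auto simp: less_Suc_eq)
  qed
  also have "\<dots> \<longleftrightarrow> dyadic_index n x = dyadic_index n y"
    using assms unfolding dyadic_index_def by (simp add: nat_eq_iff)
  finally show ?thesis .
qed

text \<open>Each factor \<open>1 + rademacher j x * rademacher j y\<close> is 2 or 0, according to whether the \<open>j\<close>-th
  digits agree.\<close>

lemma walsh_kernel:
  assumes "x \<in> {0..<1}" "y \<in> {0..<1}"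
  shows "(\<Sum>k<2 ^ n. walsh k x * walsh k y)
       = (if dyadic_index n x = dyadic_index n y then 2 ^ n else 0)"
proof (cases "\<forall>j<n. binary_digit j x = binary_digit j y")
  case True
  have "1 + rademacher j x * rademacher j y = 2" if "j < n" for j
  proof -
    have "rademacher j x = rademacher j y" using True that by (simp add: rademacher_eq_iff)
    then show ?thesis using rademacher_cases[of j y] by auto
  qed
  then show ?thesis
    using True binary_digits_eq_iff[OF assms] by (simp add: walsh_kernel_prod)
next
  case False
  then obtain j where j: "j < n" "rademacher j x \<noteq> rademacher j y"
    by (auto simp: rademacher_eq_iff)
  then have "1 + rademacher j x * rademacher j y = 0"
    using rademacher_cases[of j x] rademacher_cases[of j y] by auto
  then have "(\<Prod>j<n. 1 + rademacher j x * rademacher j y) = 0" using j(1) by auto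
  then show ?thesis
    using False binary_digits_eq_iff[OF assms] by (simp add: walsh_kernel_prod)
qed

text \<open>Orthogonality on the grid of left end points: sampling \<open>Y\<close> against the Walsh functions at the
  points \<open>i / 2 ^ n\<close> gives the coefficients, and the kernel inverts this transform.\<close>

lemma step_function_is_walsh_polynomial:
  "\<exists>c. \<forall>x\<in>{0..<1}. (\<Sum>k<2 ^ n. c k * walsh k x) = Y (dyadic_index n x)"
proof -
  define c where "c k = (\<Sum>i<2 ^ n. Y i * walsh k (real i / 2 ^ n)) / 2 ^ n" for k
  have "(\<Sum>k<2 ^ n. c k * walsh k x) = Y (dyadic_index n x)" if x: "x \<in> {0..<1}" for x
  proof -
    \<comment> \<open>The grid points represent each dyadic interval exactly once.\<close>
    have grid: "real i / 2 ^ n \<in> {0..<1} \<and> dyadic_index n (real i / 2 ^ n) = i"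
      if "i < 2 ^ n" for i
    proof -
      have "real i / 2 ^ n \<in> dyadic_interval n i"
        by (simp add: dyadic_interval_def divide_strict_right_mono)
      then show ?thesis
        using dyadic_interval_subset[OF that] dyadic_index_eq_iff[of "real i / 2 ^ n" n i] by auto
    qed
    have "(\<Sum>k<2 ^ n. c k * walsh k x)
        = (\<Sum>k<2 ^ n. \<Sum>i<2 ^ n. Y i * (walsh k (real i / 2 ^ n) * walsh k x) / 2 ^ n)"
      unfolding c_def by (simp add: sum_divide_distrib sum_distrib_right mult.assoc)
    also have "\<dots> = (\<Sum>i<2 ^ n. Y i * (\<Sum>k<2 ^ n. walsh k (real i / 2 ^ n) * walsh k x) / 2 ^ n)"
      by (subst sum.swap) (simp add: sum_divide_distrib sum_distrib_left)
    also have "\<dots> = (\<Sum>i<2 ^ n. if i = dyadic_index n x then Y i else 0)"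
      by (rule sum.cong) (use grid x in \<open>auto simp: walsh_kernel\<close>)
    also have "\<dots> = Y (dyadic_index n x)" using dyadic_index_less[OF x] by simp
    finally show ?thesis .
  qed
  then show ?thesis by blast
qed

section \<open>Partial sums as dyadic averages\<close>

lemma borel_measurable_walsh [measurable]: "walsh k \<in> borel_measurable borel"
proof -
  have "(\<lambda>x. \<Prod>j | bit k j. rademacher j x) \<in> borel_measurable borel"
    unfolding rademacher_def binary_digit_def by measurable
  then show ?thesis unfolding walsh_eq_finite_prod[abs_def] .
qed

lemma abs_walsh: "\<bar>walsh k x\<bar> = 1"
proof -
  have "\<bar>rademacher j x\<bar> = 1" for j using rademacher_cases[of j x] by auto
  then show ?thesis unfolding walsh_eq_finite_prod abs_prod by simp
qed

lemma set_integrable_mult_walsh: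
  assumes "set_integrable lborel A f"
  shows "set_integrable lborel A (\<lambda>t. f t * walsh k t)"
proof -
  have f: "integrable lborel (\<lambda>t. indicator A t *\<^sub>R f t)"
    using assms unfolding set_integrable_def .
  have [measurable]: "(\<lambda>t. indicator A t *\<^sub>R f t) \<in> borel_measurable borel"
    using borel_measurable_integrable[OF f] by simp
  have "(\<lambda>t. walsh k t * (indicator A t *\<^sub>R f t)) \<in> borel_measurable lborel"
    by measurable
  then have "integrable lborel (\<lambda>t. walsh k t * (indicator A t *\<^sub>R f t))"
    by (rule Bochner_Integration.integrable_bound[OF f]) (simp add: abs_mult abs_walsh)
  then show ?thesis unfolding set_integrable_def by (simp add: mult_ac)
qed

text \<open>The partial sum is the integral of \<open>f\<close> against the kernel, which is \<open>2 ^ n\<close> times the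
  indicator of the dyadic interval around \<open>x\<close>.\<close>

lemma walsh_partial_sum_eq_average:
  assumes f: "set_integrable lborel {0..<1} f" and x: "x \<in> {0..<1}"
  shows "walsh_partial_sum (2 ^ n) f x
       = 2 ^ n * (LBINT t:dyadic_interval n (dyadic_index n x). f t)"
proof -
  define i where "i = dyadic_index n x"
  have int: "integrable lborel (\<lambda>t. indicator {0..<1} t * (f t * walsh k t) * walsh k x)" for k
    using set_integrable_mult_walsh[OF f, of k] unfolding set_integrable_def by simp
  have "walsh_partial_sum (2 ^ n) f x
      = (\<Sum>k<2 ^ n. LBINT t. indicator {0..<1} t * (f t * walsh k t) * walsh k x)"
    unfolding walsh_partial_sum_def walsh_coeff_def set_lebesgue_integral_def by simp
  also have "\<dots> = (LBINT t. \<Sum>k<2 ^ n. indicator {0..<1} t * (f t * walsh k t) * walsh k x)"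
    by (rule Bochner_Integration.integral_sum[symmetric]) (rule int)
  also have "\<dots> = (LBINT t. 2 ^ n * (indicator (dyadic_interval n i) t * f t))"
  proof (rule Bochner_Integration.integral_cong[OF refl])
    fix t :: real
    have "i < 2 ^ n" unfolding i_def using x by (rule dyadic_index_less)
    note sub = dyadic_interval_subset[OF this]
    show "(\<Sum>k<2 ^ n. indicator {0..<1} t * (f t * walsh k t) * walsh k x)
        = 2 ^ n * (indicator (dyadic_interval n i) t * f t)"
    proof (cases "t \<in> {0..<1}")
      case True
      have "(\<Sum>k<2 ^ n. indicator {0..<1} t * (f t * walsh k t) * walsh k x)
          = f t * (\<Sum>k<2 ^ n. walsh k t * walsh k x)"
        using True by (simp add: sum_distrib_left mult.assoc)
      also have "\<dots> = f t * (if dyadic_index n t = i then 2 ^ n else 0)"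
        unfolding walsh_kernel[OF True x] i_def ..
      also have "dyadic_index n t = i \<longleftrightarrow> t \<in> dyadic_interval n i"
        using True by (simp add: dyadic_index_eq_iff)
      finally show ?thesis by simp
    next
      case False
      then show ?thesis using sub by (auto simp: indicator_def)
    qed
  qed
  finally show ?thesis unfolding set_lebesgue_integral_def i_def by simp
qed

section \<open>Primitives of step functions\<close>

definition ramp :: "real \<Rightarrow> real" where
  "ramp u = max 0 (min 1 u)"

text \<open>The primitive vanishing at 0 of the step function with integral \<open>d j\<close> over the \<open>j\<close>-th dyadic
  interval. Writing it as a sum of ramps, rather than by cases on the interval containing \<open>s\<close>,
  makes its continuity evident.\<close>

definition step_primitive :: "nat \<Rightarrow> (nat \<Rightarrow> real) \<Rightarrow> real \<Rightarrow> real" where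
  "step_primitive n d s = (\<Sum>j<2 ^ n. d j * ramp (2 ^ n * s - real j))"

lemma step_primitive_on_interval:
  assumes "s \<in> dyadic_interval n i" "i < 2 ^ n"
  shows "step_primitive n d s = (\<Sum>j<i. d j) + d i * (2 ^ n * s - real i)"
proof -
  have s: "real i \<le> 2 ^ n * s" "2 ^ n * s < real i + 1"
    using assms(1) by (simp_all add: dyadic_interval_def pos_divide_le_eq pos_less_divide_eq mult.commute)
  have "step_primitive n d s
      = (\<Sum>j<2 ^ n. if j < i then d j else if j = i then d i * (2 ^ n * s - real i) else 0)"
    unfolding step_primitive_def
  proof (rule sum.cong[OF refl])
    fix j
    have gap: "real k + 1 \<le> real l" if "k < l" for k l :: nat
      using that by linarith
    show "d j * ramp (2 ^ n * s - real j)
        = (if j < i then d j else if j = i then d i * (2 ^ n * s - real i) else 0)"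
      using s gap[of i j] gap[of j i]
      by (cases j i rule: linorder_cases) (auto simp: ramp_def)
  qed
  also have "\<dots> = (\<Sum>j<Suc i. if j < i then d j else if j = i then d i * (2 ^ n * s - real i) else 0)"
    by (rule sum.mono_neutral_right) (use assms(2) in auto)
  also have "\<dots> = (\<Sum>j<i. d j) + d i * (2 ^ n * s - real i)" by simp
  finally show ?thesis .
qed

lemma continuous_on_step_primitive: "continuous_on A (step_primitive n d)"
  unfolding step_primitive_def[abs_def] ramp_def by (intro continuous_intros)

text \<open>The same step function as \<open>\<lambda>t. 2 ^ n * d (dyadic_index n t)\<close> on the unit interval, but zero outside
  and hence integrable on the whole line, so that integrals over adjacent intervals can be added
  without case distinctions.\<close>

definition step_density :: "nat \<Rightarrow> (nat \<Rightarrow> real) \<Rightarrow> real \<Rightarrow> real" where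
  "step_density n d t = (\<Sum>j<2 ^ n. 2 ^ n * d j * indicator (dyadic_interval n j) t)"

lemma step_density_eq:
  assumes "t \<in> {0..<1}"
  shows "step_density n d t = 2 ^ n * d (dyadic_index n t)"
proof -
  have "step_density n d t = (\<Sum>j<2 ^ n. if j = dyadic_index n t then 2 ^ n * d j else 0)"
    unfolding step_density_def
    by (rule sum.cong[OF refl]) (use assms in \<open>auto simp: indicator_def dyadic_index_eq_iff[symmetric]\<close>)
  then show ?thesis using dyadic_index_less[OF assms] by simp
qed

lemma integrable_step_density: "integrable lborel (step_density n d)"
  unfolding step_density_def[abs_def] dyadic_interval_def
  by (intro Bochner_Integration.integrable_sum integrable_mult_right integrable_real_indicator)
    (auto intro!: emeasure_bounded_finite[unfolded infinity_ennreal_def])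

lemma measure_dyadic_interval_Int:
  assumes "0 \<le> s"
  shows "2 ^ n * measure lborel (dyadic_interval n j \<inter> {0..<s}) = ramp (2 ^ n * s - real j)"
proof -
  have eq: "dyadic_interval n j \<inter> {0..<s} = {real j / 2 ^ n..<min (real (Suc j) / 2 ^ n) s}"
  proof -
    have "0 \<le> real j / 2 ^ n" by simp
    then show ?thesis unfolding dyadic_interval_def by (auto simp del: of_nat_Suc)
  qed
  show ?thesis
  proof (cases "real j / 2 ^ n \<le> s")
    case True
    then have "real j / 2 ^ n \<le> min (real (Suc j) / 2 ^ n) s" 
      by (simp add: divide_right_mono)
    then have "2 ^ n * measure lborel (dyadic_interval n j \<inter> {0..<s})
        = 2 ^ n * min (real (Suc j) / 2 ^ n) s - real j"
      unfolding eq by (simp add: right_diff_distrib)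
    also have "2 ^ n * min (real (Suc j) / 2 ^ n) s = min (real (Suc j)) (2 ^ n * s)"
      by (simp add: min_mult_distrib_left)
    finally show ?thesis
      using True by (simp add: ramp_def pos_divide_le_eq mult.commute)
  next
    case False
    then have "dyadic_interval n j \<inter> {0..<s} = {}" unfolding eq by auto
    then show ?thesis using False by (simp add: ramp_def pos_divide_le_eq mult.commute)
  qed
qed

lemma integral_step_density_from_0:
  assumes "0 \<le> s"
  shows "(LBINT t=ereal 0..ereal s. step_density n d t) = step_primitive n d s"
proof -
  have "(LBINT t=ereal 0..ereal s. step_density n d t) = (LBINT t:{0..<s}. step_density n d t)"
    using assms by (simp add: interval_integral_Ico)
  also have "\<dots> = (LBINT t. \<Sum>j<2 ^ n. 2 ^ n * d j * indicator (dyadic_interval n j \<inter> {0..<s}) t)"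
    unfolding set_lebesgue_integral_def step_density_def
    by (simp add: sum_distrib_left indicator_inter_arith mult_ac)
  also have "\<dots> = (\<Sum>j<2 ^ n. LBINT t. 2 ^ n * d j * indicator (dyadic_interval n j \<inter> {0..<s}) t)"
  proof (rule Bochner_Integration.integral_sum)
    fix j
    show "integrable lborel (\<lambda>t. 2 ^ n * d j * indicator (dyadic_interval n j \<inter> {0..<s}) t)"
      unfolding dyadic_interval_def
      by (intro integrable_mult_right integrable_real_indicator)
        (auto intro!: emeasure_bounded_finite[unfolded infinity_ennreal_def])
  qed
  also have "\<dots> = (\<Sum>j<2 ^ n. d j * (2 ^ n * measure lborel (dyadic_interval n j \<inter> {0..<s})))"
    by (simp add: mult_ac)
  also have "\<dots> = step_primitive n d s"
    unfolding measure_dyadic_interval_Int[OF assms] step_primitive_def ..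
  finally show ?thesis .
qed

lemma integral_step_function:
  assumes \<phi>: "\<And>t. t \<in> {0..<1} \<Longrightarrow> \<phi> t = 2 ^ n * d (dyadic_index n t)"
    and \<xi>: "\<xi> \<in> {0..<1}" and s: "s \<in> {0..<1}"
  shows "(LBINT t=ereal \<xi>..ereal s. \<phi> t) = step_primitive n d s - step_primitive n d \<xi>"
proof -
  have "(LBINT t=ereal \<xi>..ereal s. \<phi> t) = (LBINT t=ereal \<xi>..ereal s. step_density n d t)"
  proof (rule interval_integral_cong)
    fix t assume "t \<in> einterval (min (ereal \<xi>) (ereal s)) (max (ereal \<xi>) (ereal s))"
    then have "t \<in> {0..<1}" using \<xi> s by (auto simp: einterval_iff min_def max_def split: if_splits)
    then show "\<phi> t = step_density n d t" using \<phi> step_density_eq by simp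
  qed
  moreover have "(LBINT t=ereal 0..ereal \<xi>. step_density n d t)
      + (LBINT t=ereal \<xi>..ereal s. step_density n d t)
      = (LBINT t=ereal 0..ereal s. step_density n d t)"
  proof (rule interval_integral_sum)
    show "interval_lebesgue_integrable lborel (min (ereal 0) (min (ereal \<xi>) (ereal s)))
        (max (ereal 0) (max (ereal \<xi>) (ereal s))) (step_density n d)"
      using integrable_mult_indicator[OF _ integrable_step_density]
      unfolding interval_lebesgue_integrable_def set_integrable_def by auto
  qed
  ultimately show ?thesis using \<xi> s by (simp add: integral_step_density_from_0)
qed

text \<open>The primitive is affine on the interval, so its average is its value at the midpoint; this is
  where the half of \<open>d i\<close> comes from.\<close>

lemma average_step_primitive:
  assumes "i < 2 ^ n"
  shows "2 ^ n * (LBINT s:dyadic_interval n i. step_primitive n d s - C)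
       = (\<Sum>j<i. d j) + d i / 2 - C"
proof -
  define D where "D = (\<Sum>j<i. d j) - C"
  define F where "F s = D * s + d i / 2 ^ Suc n * (2 ^ n * s - real i)\<^sup>2" for s
  define a b where "a = real i / 2 ^ n" and "b = real (Suc i) / 2 ^ n"
  have "a \<le> b" unfolding a_def b_def by (simp add: divide_right_mono)
  have "(LBINT s:dyadic_interval n i. step_primitive n d s - C)
      = (LBINT s:{a..<b}. D + d i * (2 ^ n * s - real i))"
    unfolding a_def b_def dyadic_interval_def[symmetric]
    by (rule set_lebesgue_integral_cong)
      (auto simp: dyadic_interval_def[of n i] D_def
         intro!: step_primitive_on_interval[THEN trans, OF _ assms])
  also have "\<dots> = (LBINT s=ereal a..ereal b. D + d i * (2 ^ n * s - real i))"
    using \<open>a \<le> b\<close> by (simp add: interval_integral_Ico)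
  also have "\<dots> = F b - F a"
  proof (rule interval_integral_FTC_finite)
    show "continuous_on {min a b..max a b} (\<lambda>s. D + d i * (2 ^ n * s - real i))"
      by (intro continuous_intros)
    fix s
    show "(F has_vector_derivative D + d i * (2 ^ n * s - real i)) (at s within {min a b..max a b})"
      unfolding F_def
      by (auto intro!: derivative_eq_intros simp flip: has_real_derivative_iff_has_vector_derivative)
  qed
  finally have "2 ^ n * (LBINT s:dyadic_interval n i. step_primitive n d s - C) = 2 ^ n * (F b - F a)"
    by simp
  also have "\<dots> = D + d i / 2"
  proof -
    have "2 ^ n * a = real i" "2 ^ n * b = real i + 1" unfolding a_def b_def by simp_all
    moreover from this have "2 ^ n * (D * b - D * a) = D" by (simp add: algebra_simps)
    ultimately show ?thesis unfolding F_def by (simp add: right_diff_distrib distrib_left)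
  qed
  finally show ?thesis unfolding D_def by simp
qed

section \<open>Reduction to a linear recursion\<close>

text \<open>Both sides of the equation are constant on each dyadic interval, so that the functional equation
  amounts to one scalar equation per interval.\<close>

lemma discretized_solution_step_function:
  fixes p q y :: "real \<Rightarrow> real" and Y :: "nat \<Rightarrow> real"
  assumes \<xi>: "\<xi> \<in> {0..<1}"
    and p: "set_integrable lborel {0..<1} p" and q: "set_integrable lborel {0..<1} q"
    and y: "\<And>t. t \<in> {0..<1} \<Longrightarrow> y t = Y (dyadic_index n t)"
    and d: "\<And>i. d i = (LBINT t:dyadic_interval n i. q t) - (LBINT t:dyadic_interval n i. p t) * Y i"
    and Y: "\<And>i. i < 2 ^ n \<Longrightarrow> Y i = \<eta> + ((\<Sum>j<i. d j) + d i / 2 - step_primitive n d \<xi>)"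
  shows "discretized_solution \<xi> \<eta> p q n y"
  unfolding discretized_solution_def
proof
  fix x :: real assume x: "x \<in> {0..<1}"
  define g where "g s = (LBINT t=ereal \<xi>..ereal s.
    walsh_partial_sum (2 ^ n) q t - walsh_partial_sum (2 ^ n) p t * y t)" for s
  have g: "g s = step_primitive n d s - step_primitive n d \<xi>" if "s \<in> {0..<1}" for s
    unfolding g_def
  proof (rule integral_step_function[OF _ \<xi> that])
    fix t :: real assume t: "t \<in> {0..<1}"
    show "walsh_partial_sum (2 ^ n) q t - walsh_partial_sum (2 ^ n) p t * y t
        = 2 ^ n * d (dyadic_index n t)"
      unfolding walsh_partial_sum_eq_average[OF p t] walsh_partial_sum_eq_average[OF q t] y[OF t] d
      by (simp add: algebra_simps)
  qed
  have "set_integrable lborel {0..1} (\<lambda>s. step_primitive n d s - step_primitive n d \<xi>)"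
    by (rule borel_integrable_atLeastAtMost')
      (intro continuous_intros continuous_on_step_primitive)
  then have "set_integrable lborel {0..<1} (\<lambda>s. step_primitive n d s - step_primitive n d \<xi>)"
    by (rule set_integrable_subset) auto
  then have "set_integrable lborel {0..<1} g"
    by (rule set_integrable_cong[THEN iffD1, rotated -1]) (auto simp: g)
  then have "walsh_partial_sum (2 ^ n) g x
      = 2 ^ n * (LBINT s:dyadic_interval n (dyadic_index n x). g s)"
    using x by (rule walsh_partial_sum_eq_average)
  also have "(LBINT s:dyadic_interval n (dyadic_index n x). g s)
      = (LBINT s:dyadic_interval n (dyadic_index n x). step_primitive n d s - step_primitive n d \<xi>)"
    using g dyadic_interval_subset[OF dyadic_index_less[OF x], of n]
    by (intro set_lebesgue_integral_cong) (auto simp: dyadic_interval_def[of n "dyadic_index n x"] subset_iff)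
  also have "2 ^ n * \<dots> = (\<Sum>j<dyadic_index n x. d j) + d (dyadic_index n x) / 2 - step_primitive n d \<xi>"
    by (rule average_step_primitive) (rule dyadic_index_less[OF x])
  finally show "y x = \<eta> + walsh_partial_sum (2 ^ n) (\<lambda>s. LBINT t=ereal \<xi>..ereal s.
      walsh_partial_sum (2 ^ n) q t - walsh_partial_sum (2 ^ n) p t * y t) x"
    using Y[OF dyadic_index_less[OF x]] y[OF x] unfolding g_def by simp
qed

text \<open>The recursion can be run backwards below \<open>m\<close>, where its slopes can be divided by, and forwards
  above \<open>m\<close>.\<close>

lemma affine_recursion_through_value:
  fixes A B :: "nat \<Rightarrow> real"
  assumes "\<And>i. i < m \<Longrightarrow> A i \<noteq> 0"
  shows "\<exists>Y. Y m = v \<and> (\<forall>i. Y (Suc i) = A i * Y i + B i)"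
  using assms
proof (induction m arbitrary: v)
  case 0
  have "\<exists>Y. Y 0 = v \<and> (\<forall>i. Y (Suc i) = A i * Y i + B i)"
    by (rule exI[of _ "rec_nat v (\<lambda>i z. A i * z + B i)"]) simp
  then show ?case .
next
  case (Suc m)
  obtain Y where Y: "Y m = (v - B m) / A m" "\<And>i. Y (Suc i) = A i * Y i + B i"
    using Suc.IH[of "(v - B m) / A m"] Suc.prems by auto
  then have "Y (Suc m) = v" using Suc.prems[of m] by simp
  then show ?case using Y(2) by blast
qed

text \<open>The index \<open>m\<close> is that of the interval containing \<open>\<xi>\<close>, and \<open>\<theta>\<close> is the relative position of \<open>\<xi>\<close> in it. Let
  \<open>E i\<close> be \<open>Y i\<close> minus the midpoint value of the primitive. The system says that \<open>E\<close> is
  constant with a prescribed value. Constancy is the recursion with slopes \<open>A\<close> and offsets \<open>B\<close>,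
  and the prescribed value is attained at \<open>m\<close>, where the sums over \<open>j < m\<close> cancel and leave a
  scalar equation with solution \<open>v\<close>. The bound 2 keeps the slopes and all the
  denominators positive.\<close>

lemma nodal_system_solvable:
  fixes a b :: "nat \<Rightarrow> real"
  assumes a: "\<And>i. i < N \<Longrightarrow> \<bar>a i\<bar> < 2" and m: "m < N" and \<theta>: "0 \<le> \<theta>" "\<theta> \<le> 1"
  shows "\<exists>Y. \<forall>i<N. Y i = \<eta> + ((\<Sum>j<i. b j - a j * Y j) + (b i - a i * Y i) / 2
          - ((\<Sum>j<m. b j - a j * Y j) + (b m - a m * Y m) * \<theta>))"
proof -
  define A where "A i = (1 - a i / 2) / (1 + a (Suc i) / 2)" for i
  define B where "B i = (b i + b (Suc i)) / 2 / (1 + a (Suc i) / 2)" for i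
  define v where "v = (\<eta> + (1 / 2 - \<theta>) * b m) / (1 + (1 / 2 - \<theta>) * a m)"
  have A_nz: "A i \<noteq> 0" if "i < m" for i
    using a[of i] a[of "Suc i"] that m unfolding A_def by auto
  obtain Y where Ym: "Y m = v" and Y: "\<And>i. Y (Suc i) = A i * Y i + B i"
    using affine_recursion_through_value[of m A v B] A_nz by blast
  define d where "d i = b i - a i * Y i" for i
  define E where "E i = Y i - ((\<Sum>j<i. d j) + d i / 2)" for i
  have "\<bar>1 / 2 - \<theta>\<bar> \<le> 1 / 2" using \<theta> by linarith
  then have "\<bar>(1 / 2 - \<theta>) * a m\<bar> \<le> 1 / 2 * \<bar>a m\<bar>"
    unfolding abs_mult by (rule mult_right_mono) simp
  then have "1 + (1 / 2 - \<theta>) * a m \<noteq> 0" using a[OF m] by linarith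
  then have "v * (1 + (1 / 2 - \<theta>) * a m) = \<eta> + (1 / 2 - \<theta>) * b m" unfolding v_def by simp
  then have Em: "E m = \<eta> - ((\<Sum>j<m. d j) + d m * \<theta>)"
    unfolding E_def d_def Ym by (simp add: algebra_simps diff_divide_distrib)
  have E_Suc: "E (Suc i) = E i" if "Suc i < N" for i
  proof -
    have nz: "1 + a (Suc i) / 2 \<noteq> 0" using a[OF that] by linarith
    have "Y (Suc i) = ((1 - a i / 2) * Y i + (b i + b (Suc i)) / 2) / (1 + a (Suc i) / 2)"
      unfolding Y A_def B_def by (simp add: add_divide_distrib)
    then have "Y (Suc i) * (1 + a (Suc i) / 2) = (1 - a i / 2) * Y i + (b i + b (Suc i)) / 2"
      using nz by simp
    then show ?thesis unfolding E_def d_def by (simp add: algebra_simps add_divide_distrib diff_divide_distrib)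
  qed
  have E_0: "E i = E 0" if "i < N" for i
    using that by (induction i) (auto simp: E_Suc)
  have "Y i = \<eta> + ((\<Sum>j<i. d j) + d i / 2 - ((\<Sum>j<m. d j) + d m * \<theta>))" if "i < N" for i
    using E_0[OF that] E_0[OF m] Em unfolding E_def[of i] by linarith
  then show ?thesis unfolding d_def by (intro exI allI impI)
qed

section \<open>Integrals over small dyadic intervals\<close>

text \<open>Absolute continuity of the integral, obtained here from the uniform continuity of the primitive
  on the compact unit interval.\<close>

lemma integral_dyadic_interval_small:
  fixes p :: "real \<Rightarrow> real"
  assumes p: "set_integrable lborel {0..<1} p" and "0 < \<epsilon>"
  shows "\<exists>n\<^sub>0. \<forall>n\<ge>n\<^sub>0. \<forall>i<2 ^ n. \<bar>LBINT t:dyadic_interval n i. p t\<bar> < \<epsilon>"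
proof -
  define F where "F x = integral {0..x} p" for x
  have "p integrable_on {0..<1}" using p by (rule set_borel_integral_eq_integral(1))
  then have int: "p integrable_on {0..1}"
    by (rule integrable_spike_set) (auto intro: negligible_subset[of "{1}"])
  then have "continuous_on {0..1} F"
    unfolding F_def by (rule indefinite_integral_continuous_1)
  then have "uniformly_continuous_on {0..1} F"
    by (rule compact_uniformly_continuous) simp
  then obtain \<delta> where "0 < \<delta>"
    and \<delta>: "\<And>u v. u \<in> {0..1} \<Longrightarrow> v \<in> {0..1} \<Longrightarrow> dist v u < \<delta> \<Longrightarrow> dist (F v) (F u) < \<epsilon>"
    using \<open>0 < \<epsilon>\<close> unfolding uniformly_continuous_on_def by metis
  obtain n\<^sub>0 where n\<^sub>0: "(1 / 2) ^ n\<^sub>0 < \<delta>"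
    using real_arch_pow_inv[OF \<open>0 < \<delta>\<close>, of "1 / 2"] by auto
  have "\<bar>LBINT t:dyadic_interval n i. p t\<bar> < \<epsilon>" if "n\<^sub>0 \<le> n" "i < 2 ^ n" for n i
  proof -
    define u v where "u = real i / 2 ^ n" and "v = real (Suc i) / 2 ^ n"
    have "v - u = (1 / 2) ^ n" unfolding u_def v_def by (simp add: field_simps)
    also have "\<dots> \<le> (1 / 2) ^ n\<^sub>0" using that(1) by (intro power_decreasing) auto
    finally have close: "v - u < \<delta>" using n\<^sub>0 by simp
    have "real (Suc i) \<le> 2 ^ n" using that(2)
      by (metis Suc_leI of_nat_le_iff of_nat_numeral of_nat_power)
    then have uv: "0 \<le> u" "u \<le> v" "v \<le> 1" unfolding u_def v_def by (auto simp: divide_right_mono)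
    have "(LBINT t:dyadic_interval n i. p t) = integral {u..<v} p"
      unfolding u_def v_def dyadic_interval_def[symmetric]
      by (rule set_borel_integral_eq_integral(2), rule set_integrable_subset[OF p])
        (use dyadic_interval_subset[OF that(2)] in \<open>auto simp: dyadic_interval_def\<close>)
    also have "\<dots> = integral {u..v} p"
      by (rule integral_spike_set) (auto intro: negligible_subset[of "{v}"])
    also have "\<dots> = F v - F u"
    proof -
      have "p integrable_on {0..v}" using int by (rule integrable_on_subinterval) (use uv in auto)
      then show ?thesis
        using Henstock_Kurzweil_Integration.integral_combine[OF uv(1,2)] unfolding F_def by force
    qed
    finally show ?thesis using \<delta>[of u v] uv close by (simp add: dist_real_def)
  qed
  then show ?thesis by (intro exI allI impI)
qed

section \<open>Solvability of the discretized equation\<close>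

theorem theorem3p1:
  fixes \<xi> \<eta> :: real and p q :: "real \<Rightarrow> real"
  assumes "\<xi> \<in> {0..<1}"
    and "continuous_on {0..<1} p" and "continuous_on {0..<1} q"
    and "set_integrable lborel {0..<1} p" and "set_integrable lborel {0..<1} q"
  shows "\<exists>n_star :: nat. \<forall>n\<ge>n_star. \<exists>c :: nat \<Rightarrow> real.
           discretized_solution \<xi> \<eta> p q n (\<lambda>x. \<Sum>k<2 ^ n. c k * walsh k x)"
proof -
  obtain n\<^sub>0 where small: "\<bar>LBINT t:dyadic_interval n i. p t\<bar> < 2" if "n\<^sub>0 \<le> n" "i < 2 ^ n" for n i
    using integral_dyadic_interval_small[OF assms(4), of 2] by auto
  have "\<exists>c. discretized_solution \<xi> \<eta> p q n (\<lambda>x. \<Sum>k<2 ^ n. c k * walsh k x)" if n: "n\<^sub>0 \<le> n" for n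
  proof -
    define a where "a i = (LBINT t:dyadic_interval n i. p t)" for i
    define b where "b i = (LBINT t:dyadic_interval n i. q t)" for i
    define m where "m = dyadic_index n \<xi>"
    have "0 \<le> \<xi>" using assms(1) by simp
    have m: "m < 2 ^ n" "\<xi> \<in> dyadic_interval n m"
      unfolding m_def using dyadic_index_less[OF assms(1)] dyadic_index_eq_iff[OF \<open>0 \<le> \<xi>\<close>] by auto
    have \<theta>: "0 \<le> 2 ^ n * \<xi> - real m" "2 ^ n * \<xi> - real m \<le> 1"
      using dyadic_index_bounds[OF \<open>0 \<le> \<xi>\<close>, of n] unfolding m_def by linarith+
    have a: "\<bar>a i\<bar> < 2" if "i < 2 ^ n" for i unfolding a_def using n that by (rule small)
    obtain Y where Y: "\<And>i. i < 2 ^ n \<Longrightarrow>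
        Y i = \<eta> + ((\<Sum>j<i. b j - a j * Y j) + (b i - a i * Y i) / 2
          - ((\<Sum>j<m. b j - a j * Y j) + (b m - a m * Y m) * (2 ^ n * \<xi> - real m)))"
      using nodal_system_solvable[of "2 ^ n" a m, OF a m(1) \<theta>] by blast
    obtain c where c: "\<And>x. x \<in> {0..<1} \<Longrightarrow> (\<Sum>k<2 ^ n. c k * walsh k x) = Y (dyadic_index n x)"
      using step_function_is_walsh_polynomial[of n Y] by blast
    have "discretized_solution \<xi> \<eta> p q n (\<lambda>x. \<Sum>k<2 ^ n. c k * walsh k x)"
    proof (rule discretized_solution_step_function[OF assms(1,4,5),
          where Y = Y and d = "\<lambda>i. b i - a i * Y i"])
      show "(\<Sum>k<2 ^ n. c k * walsh k t) = Y (dyadic_index n t)" if "t \<in> {0..<1}" for t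
        using that by (rule c)
      show "b i - a i * Y i
          = (LBINT t:dyadic_interval n i. q t) - (LBINT t:dyadic_interval n i. p t) * Y i" for i
        unfolding a_def b_def ..
      show "Y i = \<eta> + ((\<Sum>j<i. b j - a j * Y j) + (b i - a i * Y i) / 2
          - step_primitive n (\<lambda>i. b i - a i * Y i) \<xi>)" if "i < 2 ^ n" for i
        unfolding step_primitive_on_interval[OF m(2,1)] using Y[OF that] .
    qed
    then show ?thesis by blast
  qed
  then show ?thesis by blast
qed

end
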